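(* Let $\mathcal V,\mathcal H$ be real Hilbert spaces with norms $\|\cdot\|$ and $|||\cdot|||$, let $\mathcal V'$ be the dual of $\mathcal V$ with norm $\|\cdot\|_*$, and let $a:\mathcal V\times\mathcal V\to\mathbb R$ and $b:\mathcal H\times\mathcal V\to\mathbb R$ be bilinear forms such that, for positive constants $C_a,C_b,\alpha,\beta$, $$a(v,w)\le C_a\|v\|\,\|w\|\quad\forall v,w\in\mathcal V,\qquad b(p,w)\le C_b|||p|||\,\|w\|\quad\forall p\in\mathcal H,\ w\in\mathcal V,$$ $$a(u,u)\ge\alpha\|u\|^2\quad\forall u\in\mathcal V,\qquad \inf_{p\in\mathcal H}\sup_{v\in\mathcal V}\frac{b(p,v)}{|||p|||\,\|v\|}\ge\beta .$$ Let $A:\mathcal V\to\mathcal V'$ and $B:\mathcal H\to\mathcal V'$ be the operators defined by $\langle Au,v\rangle=a(u,v)$ and $\langle Bp,v\rangle=b(p,v)$ for all $v\in\mathcal V$. Let $U\subset\mathcal V$ and $Q\subset\mathcal H$ be finite dimensional subspaces, and let $\mathbf c:\mathcal V'\times\mathcal V'\to\mathbb R$ be a bilinear form such that, for positive constants $C_\star,c_\star$, $$\mathbf c(\eta,\zeta)\le C_\star\|\eta\|_*\|\zeta\|_*\quad\forall\eta,\zeta\in\mathcal V',\qquad \mathbf c(Bq,Bq)\ge c_\star\|Bq\|_*^2\quad\forall q\in Q .$$ For $\gamma>0$ define, for $u,v\in\mathcal V$ and $p,q\in\mathcal H$, $$\widehat{\mathfrak a}_\gamma(u,p;v,q)=a(u,v)-b(p,v)+b(q,u)-\gamma\,\mathbf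 c(Au-Bp,Bq).$$ Then there exists $\gamma_0>0$ such that for all $0<\gamma<\gamma_0$ the bilinear form $\widehat{\mathfrak a}_\gamma$ is coercive on $U\times Q$, that is, there exists $\widehat\beta_\gamma>0$ such that $$\widehat{\mathfrak a}_\gamma(v,q;v,q)\ge\widehat\beta_\gamma\left(\|v\|^2+|||q|||^2\right)\qquad\forall v\in U,\ q\in Q .$$
   Context: $\langle\cdot,\cdot\rangle$ denotes the duality pairing between $\mathcal V'$ and $\mathcal V$, and $\|\cdot\|_*$ is the dual norm $\|\eta\|_*=\sup_{v\in\mathcal V,\,v\ne0}\langle\eta,v\rangle/\|v\|$. Infima and suprema of quotients are taken over nonzero elements. *)

theory Defs
  imports "HOL-Analysis.Analysis"
begin

text \<open>
  A real Hilbert space is a type of class \<open>{real_inner, complete_space}\<close>, and the dual of \<open>'v\<close> is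
  the type \<open>'v \<Rightarrow>\<^sub>L real\<close> of bounded linear functionals with its operator norm. Bilinear forms are
  \<open>bilinear\<close> in the purely algebraic sense; continuity is a separate hypothesis.
\<close>

text \<open>The operator norm is the dual norm \<open>sup {\<eta> v / \<parallel>v\<parallel> | v \<noteq> 0}\<close>, without absolute values.\<close>

lemma norm_dual_eq_SUP:
  fixes \<eta> :: "'v::real_normed_vector \<Rightarrow>\<^sub>L real"
  assumes "\<exists>v::'v. v \<noteq> 0"
  shows "norm \<eta> = (SUP v\<in>- {0}. blinfun_apply \<eta> v / norm v)"
proof (rule antisym)
  let ?q = "\<lambda>v. blinfun_apply \<eta> v / norm v"
  have le: "\<bar>blinfun_apply \<eta> v\<bar> \<le> norm \<eta> * norm v" for v
    using norm_blinfun[of \<eta> v] by simp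
  have ub: "?q v \<le> norm \<eta>" if "v \<in> - {0}" for v
    using le[of v] that by (simp add: divide_le_eq)
  then have bdd: "bdd_above (?q ` (- {0}))"
    by (intro bdd_aboveI2)
  show "(SUP v\<in>- {0}. ?q v) \<le> norm \<eta>"
    using assms ub by (intro cSUP_least) auto
  have up: "blinfun_apply \<eta> v \<le> (SUP v\<in>- {0}. ?q v) * norm v" if "v \<noteq> 0" for v
  proof -
    have "?q v \<le> (SUP v\<in>- {0}. ?q v)"
      using that by (intro cSUP_upper bdd) simp
    with that show ?thesis
      by (simp add: pos_divide_le_eq)
  qed
  have abs_le: "\<bar>blinfun_apply \<eta> v\<bar> \<le> (SUP v\<in>- {0}. ?q v) * norm v" if "v \<noteq> 0" for v
    using up[of v] up[of "- v"] that by (simp add: blinfun.minus_right abs_le_iff)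
  obtain w :: 'v where "w \<noteq> 0"
    using assms by blast
  then have "0 \<le> (SUP v\<in>- {0}. ?q v) * norm w"
    using abs_le[of w] by linarith
  with \<open>w \<noteq> 0\<close> have "0 \<le> (SUP v\<in>- {0}. ?q v)"
    by (simp add: zero_le_mult_iff)
  then show "norm \<eta> \<le> (SUP v\<in>- {0}. ?q v)"
  proof (rule norm_blinfun_bound)
    show "norm (blinfun_apply \<eta> v) \<le> (SUP v\<in>- {0}. ?q v) * norm v" for v
      using abs_le[of v] by (cases "v = 0") (simp_all add: blinfun.zero_right)
  qed
qed

text \<open>
  The operator \<open>F : X \<rightarrow> V'\<close> with \<open>\<langle>F x, v\<rangle> = f(x, v)\<close>. It is meaningful only if every \<open>f x\<close> is a bounded
  linear functional, since \<open>Blinfun\<close> is unspecified elsewhere.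
\<close>

definition form_operator ::
    "('x \<Rightarrow> 'v::real_normed_vector \<Rightarrow> real) \<Rightarrow> 'x \<Rightarrow> ('v \<Rightarrow>\<^sub>L real)" where
  "form_operator f x = Blinfun (f x)"

lemma form_operator_apply:
  fixes f :: "'x::real_normed_vector \<Rightarrow> 'v::real_normed_vector \<Rightarrow> real"
  assumes "bilinear f" and "\<And>x v. f x v \<le> C * norm x * norm v"
  shows "blinfun_apply (form_operator f x) v = f x v"
proof -
  have "\<bar>f x v\<bar> \<le> norm v * (C * norm x)" for v
    using assms(2)[of x v] assms(2)[of x "- v"]
    by (simp add: bilinear_rneg[OF assms(1)] abs_le_iff mult_ac)
  moreover have "linear (f x)"
    using assms(1) unfolding bilinear_def by simp
  ultimately have "bounded_linear (f x)"
    unfolding bounded_linear_def bounded_linear_axioms_def real_norm_def by blast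
  then show ?thesis
    by (simp add: form_operator_def bounded_linear_Blinfun_apply)
qed

definition finite_dim_subspace :: "'a::real_vector set \<Rightarrow> bool" where
  "finite_dim_subspace S \<longleftrightarrow> subspace S \<and> (\<exists>B. finite B \<and> span B = S)"

text \<open>
  The infimum and supremum are taken in the extended reals, so that
  they need no boundedness or nonemptiness conditions.
\<close>

definition inf_sup_const ::
    "('h::real_normed_vector \<Rightarrow> 'v::real_normed_vector \<Rightarrow> real) \<Rightarrow> ereal" where
  "inf_sup_const b = (INF p\<in>- {0}. SUP v\<in>- {0}. ereal (b p v / (norm p * norm v)))"

definition a_hat ::
    "('v::real_normed_vector \<Rightarrow> 'v \<Rightarrow> real) \<Rightarrow> ('h \<Rightarrow> 'v \<Rightarrow> real) \<Rightarrow>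
     (('v \<Rightarrow>\<^sub>L real) \<Rightarrow> ('v \<Rightarrow>\<^sub>L real) \<Rightarrow> real) \<Rightarrow> real \<Rightarrow> 'v \<times> 'h \<Rightarrow> 'v \<times> 'h \<Rightarrow> real" where
  "a_hat a b c \<gamma> = (\<lambda>(u, p) (v, q).
     a u v - b p v + b q u
     - \<gamma> * c (form_operator a u - form_operator b p) (form_operator b q))"

end

theory Submission
  imports Defs
begin

text \<open>
  On the diagonal the two \<open>b\<close>-terms cancel, leaving \<open>a(v,v) - \<gamma> c(Av,Bq) + \<gamma> c(Bq,Bq)\<close>. The mixed term
  is at most \<open>\<gamma> C\<^sub>\<star> C\<^sub>a \<parallel>v\<parallel> \<parallel>Bq\<parallel>\<close>; Young's inequality absorbs half of \<open>\<gamma> c\<^sub>\<star> \<parallel>Bq\<parallel>\<^sup>2\<close> and, for small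
  \<open>\<gamma>\<close>, half of \<open>\<alpha> \<parallel>v\<parallel>\<^sup>2\<close>. The inf-sup condition gives \<open>\<parallel>Bq\<parallel> \<ge> \<beta> \<parallel>q\<parallel>\<close> for every \<open>q\<close>.
\<close>

lemma norm_form_operator_le:
  fixes f :: "'x::real_normed_vector \<Rightarrow> 'v::real_normed_vector \<Rightarrow> real"
  assumes "bilinear f" and "\<And>x v. f x v \<le> C * norm x * norm v" and "C \<ge> 0"
  shows "norm (form_operator f x) \<le> C * norm x"
proof (rule norm_blinfun_bound)
  show "norm (blinfun_apply (form_operator f x) v) \<le> C * norm x * norm v" for v
    \<comment> \<open>Testing with both \<open>v\<close> and \<open>- v\<close> turns the one-sided
      bound into a bound on the absolute value.\<close>
    using assms(2)[of x v] assms(2)[of x "- v"]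
    by (simp add: form_operator_apply[OF assms(1,2)] bilinear_rneg[OF assms(1)] abs_le_iff)
qed (use assms(3) in simp)

text \<open>For fixed nonzero \<open>x\<close>, every quotient in the inner supremum is at most the
  dual norm of the functional divided by \<open>norm x\<close>, so the inf-sup constant bounds that
  ratio from below. The infimum omits \<open>x = 0\<close>, where both sides vanish.\<close>

lemma norm_form_operator_ge:
  fixes f :: "'x::real_normed_vector \<Rightarrow> 'v::real_normed_vector \<Rightarrow> real"
  assumes "bilinear f" and "\<And>x v. f x v \<le> C * norm x * norm v"
    and "inf_sup_const f \<ge> ereal \<beta>"
  shows "\<beta> * norm x \<le> norm (form_operator f x)"
proof (cases "x = 0")
  case False
  have "ereal \<beta> \<le> (SUP v\<in>- {0}. ereal (f x v / (norm x * norm v)))"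
    using assms(3) False unfolding inf_sup_const_def by (simp add: le_INF_iff)
  also have "\<dots> \<le> ereal (norm (form_operator f x) / norm x)"
  proof (rule SUP_least)
    fix v :: 'v
    assume "v \<in> - {0}"
    moreover have "f x v \<le> norm (form_operator f x) * norm v"
      using norm_blinfun[of "form_operator f x" v]
      by (simp add: form_operator_apply[OF assms(1,2)])
    ultimately show "ereal (f x v / (norm x * norm v)) \<le> ereal (norm (form_operator f x) / norm x)"
      using False by (simp add: field_simps)
  qed
  finally show ?thesis
    using False by (simp add: pos_le_divide_eq)
qed simp

lemma a_hat_diagonal:
  assumes "bilinear c"
  shows "a_hat a b c \<gamma> (v, q) (v, q) =
    a v v - \<gamma> * c (form_operator a v) (form_operator b q)
      + \<gamma> * c (form_operator b q) (form_operator b q)"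
  by (simp add: a_hat_def bilinear_lsub[OF assms] algebra_simps)

text \<open>Completing the square: \<open>2 * k\<close> times the difference of the two sides equals
  \<open>\<gamma> * (K * x - k * y)\<^sup>2 + (\<alpha> * k - \<gamma> * K\<^sup>2) *
  x\<^sup>2\<close>, and the smallness of \<gamma> makes the second term nonnegative.\<close>

lemma young_absorb:
  fixes \<alpha> k K \<gamma> x y :: real
  assumes "k > 0" and "0 \<le> \<gamma>" and "\<gamma> * K\<^sup>2 \<le> \<alpha> * k"
  shows "\<alpha> / 2 * x\<^sup>2 + \<gamma> * k / 2 * y\<^sup>2 \<le> \<alpha> * x\<^sup>2 - \<gamma> * (K * x * y) + \<gamma> * (k * y\<^sup>2)"
proof -
  have "0 \<le> \<gamma> * (K * x - k * y)\<^sup>2 + (\<alpha> * k - \<gamma> * K\<^sup>2) * x\<^sup>2"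
    using assms by simp
  also have "\<dots> = k * (\<alpha> * x\<^sup>2 - 2 * \<gamma> * (K * x * y) + \<gamma> * (k * y\<^sup>2))"
    by (simp add: power2_eq_square algebra_simps)
  finally have "0 \<le> \<alpha> * x\<^sup>2 - 2 * \<gamma> * (K * x * y) + \<gamma> * (k * y\<^sup>2)"
    using assms(1) by (simp add: zero_le_mult_iff)
  then show ?thesis
    by (simp add: algebra_simps)
qed

theorem theorem3p1:
  fixes a :: "'v::{real_inner, complete_space} \<Rightarrow> 'v \<Rightarrow> real"
    and b :: "'h::{real_inner, complete_space} \<Rightarrow> 'v \<Rightarrow> real"
    and c :: "('v \<Rightarrow>\<^sub>L real) \<Rightarrow> ('v \<Rightarrow>\<^sub>L real) \<Rightarrow> real"
    and U :: "'v set" and Q :: "'h set"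
    and C_a C_b \<alpha> \<beta> C_star c_star :: real
  assumes "bilinear a" and "bilinear b" and "bilinear c"
    and "C_a > 0" and "C_b > 0" and "\<alpha> > 0" and "\<beta> > 0" and "C_star > 0" and "c_star > 0"
    and "\<forall>v w. a v w \<le> C_a * norm v * norm w"
    and "\<forall>p w. b p w \<le> C_b * norm p * norm w"
    and "\<forall>u. a u u \<ge> \<alpha> * (norm u)\<^sup>2"
    and "inf_sup_const b \<ge> ereal \<beta>"
    and "finite_dim_subspace U" and "finite_dim_subspace Q"
    and "\<forall>\<eta> \<zeta>. c \<eta> \<zeta> \<le> C_star * norm \<eta> * norm \<zeta>"
    and "\<forall>q\<in>Q. c (form_operator b q) (form_operator b q) \<ge> c_star * (norm (form_operator b q))\<^sup>2"
  shows "\<exists>\<gamma>\<^sub>0>0. \<forall>\<gamma>. 0 < \<gamma> \<and> \<gamma> < \<gamma>\<^sub>0 \<longrightarrow>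
           (\<exists>\<beta>\<^sub>\<gamma>>0. \<forall>v\<in>U. \<forall>q\<in>Q.
              a_hat a b c \<gamma> (v, q) (v, q) \<ge> \<beta>\<^sub>\<gamma> * ((norm v)\<^sup>2 + (norm q)\<^sup>2))"
\<comment> \<open>This threshold is the smallness condition of \<open>young_absorb\<close> solved
  for \<gamma>, with \<open>K = C_star * C_a\<close> and \<open>k = c_star\<close>.\<close>
proof (rule exI[of _ "\<alpha> * c_star / (C_star * C_a)\<^sup>2"], intro conjI allI impI)
  let ?A = "form_operator a" and ?B = "form_operator b" and ?K = "C_star * C_a"
  show "\<alpha> * c_star / ?K\<^sup>2 > 0"
    using assms by simp
  fix \<gamma> :: real
  assume \<gamma>: "0 < \<gamma> \<and> \<gamma> < \<alpha> * c_star / ?K\<^sup>2"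
  have small: "\<gamma> * ?K\<^sup>2 \<le> \<alpha> * c_star"
    using \<gamma> assms(4,8) by (simp add: pos_less_divide_eq less_imp_le)
  \<comment> \<open>The two entries are the coefficients that survive absorption; the factor
    \<open>\<beta>\<^sup>2\<close> comes from trading \<open>norm (?B q)\<close> for
    \<open>norm q\<close>.\<close>
  let ?m = "min (\<alpha> / 2) (\<gamma> * c_star / 2 * \<beta>\<^sup>2)"
  show "\<exists>\<beta>\<^sub>\<gamma>>0. \<forall>v\<in>U. \<forall>q\<in>Q.
      a_hat a b c \<gamma> (v, q) (v, q) \<ge> \<beta>\<^sub>\<gamma> * ((norm v)\<^sup>2 + (norm q)\<^sup>2)"
  proof (intro exI[of _ ?m] conjI ballI)
    show "?m > 0"
      using assms \<gamma> by simp
    fix v q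
    assume "v \<in> U" "q \<in> Q"
    have "(\<beta> * norm q)\<^sup>2 \<le> (norm (?B q))\<^sup>2"
      using norm_form_operator_ge[of b C_b \<beta> q] assms by (intro power_mono) auto
    then have "\<gamma> * c_star / 2 * (\<beta> * norm q)\<^sup>2 \<le> \<gamma> * c_star / 2 * (norm (?B q))\<^sup>2"
      using \<gamma> assms by (intro mult_left_mono) auto
    moreover have "?m * (norm v)\<^sup>2 \<le> \<alpha> / 2 * (norm v)\<^sup>2"
      by (intro mult_right_mono) auto
    moreover have "?m * (norm q)\<^sup>2 \<le> \<gamma> * c_star / 2 * \<beta>\<^sup>2 * (norm q)\<^sup>2"
      by (intro mult_right_mono) auto
    ultimately have "?m * ((norm v)\<^sup>2 + (norm q)\<^sup>2)
        \<le> \<alpha> / 2 * (norm v)\<^sup>2 + \<gamma> * c_star / 2 * (norm (?B q))\<^sup>2"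
      by (simp only: distrib_left power_mult_distrib mult.assoc)
    also have "\<dots> \<le> \<alpha> * (norm v)\<^sup>2 - \<gamma> * (?K * norm v * norm (?B q))
        + \<gamma> * (c_star * (norm (?B q))\<^sup>2)"
      using young_absorb[OF _ _ small] \<gamma> assms by simp
    also have "\<dots> \<le> a v v - \<gamma> * c (?A v) (?B q) + \<gamma> * c (?B q) (?B q)"
    proof -
      \<comment> \<open>The mixed term enters with the factor \<open>- \<gamma>\<close>, so an upper
        bound on it gives the lower bound on the form.\<close>
      have "c (?A v) (?B q) \<le> C_star * norm (?A v) * norm (?B q)"
        using assms by blast
      also have "\<dots> \<le> C_star * (C_a * norm v) * norm (?B q)"
        using norm_form_operator_le[of a C_a v] assms
        by (intro mult_right_mono mult_left_mono) auto
      finally have "c (?A v) (?B q) \<le> ?K * norm v * norm (?B q)"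
        by (simp add: mult.assoc)
      \<comment> \<open>Coercivity of \<open>a\<close> handles the first term;
        \<open>q \<in> Q\<close> gives the lower bound for \<open>c\<close> on the diagonal at
        \<open>?B q\<close>.\<close>
      then show ?thesis
        using \<gamma> assms(12,17) \<open>q \<in> Q\<close>
        by (intro add_mono diff_mono mult_left_mono) auto
    qed
    also have "\<dots> = a_hat a b c \<gamma> (v, q) (v, q)"
      by (simp add: a_hat_diagonal[OF assms(3)])
    finally show "a_hat a b c \<gamma> (v, q) (v, q) \<ge> ?m * ((norm v)\<^sup>2 + (norm q)\<^sup>2)" .
  qed
qed

end
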